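(* Let $\mathcal{H}=(V,\mathcal{E})$ be a hypergraph with maximum vertex degree $\Delta$ and maximum edge size $\ell$, let $\mathbf{b}=(b_1,\dots,b_n)\in\mathbb{N}_{\ge2}^n$, $b=\min_i b_i$, $\delta=\Delta-b+1$. Let $\alpha=\frac{(b-1)\delta e^{\delta/4}}{47\ell}$ and $t=73$. If $|C_1|<\alpha\cdot\mathrm{Opt}^*$ and $t|C_1|<|C_2|$, where $C_1,C_2$ are the sets computed by Algorithm SET $b$-MULTICOVER (described in the context), then this algorithm returns a set multicover $C$ such that $$|C|<\frac{15\delta+14}{20}\cdot\mathrm{Opt}$$ with probability greater than $0.53$.
   Context: A hypergraph $\mathcal{H}=(V,\mathcal{E})$ has a finite nonempty vertex set $V=\{v_1,\dots,v_n\}$ and edges $\mathcal{E}=\{E_1,\dots,E_m\}$, $E_j\subseteq V$. The degree $d(v)$ is the number of edges containing $v$; $\Delta$ is the maximum degree and $\ell$ the maximum edge size. Given $\mathbf{b}=(b_1,\dots,b_n)$ with integers $b_i\ge 2$, a set multicover is a set $C\subseteq\mathcal{E}$ such that every $v_i$ lies in at least $b_i$ edges of $C$ (then $v_i$ is called fully covered). It is assumed that $d(v_i)\ge b_i$ for all $i$ (feasibility). $\mathrm{Opt}$ is the minimum cardinality of a set multicover. The LP relaxation is: minimize $\sum_{j=1}^m x_j$ subject to $\sum_{j: v_i\in E_j} x_j\ge b_i$ for all $i$ and $x_j\in[0,1]$ for all $j$; $\mathrm{Opt}^*$ is its optimal value. Algorithm SET $b$-MULTICOVER: put $\lambda=\frac{\delta+1}{2}$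 and compute an optimal solution $x^*$ of the LP relaxation. Let $C_1=\{E_j: x_j^*\ge \frac1\lambda\}$, $C_2=\{E_j: \frac1\delta\le x_j^*<\frac1\lambda\}$, $C_3=\{E_j: 0<x_j^*<\frac1\lambda\}$. If $|C_1|\ge\alpha\,\mathrm{Opt}^*$ or $t|C_1|\ge|C_2|$, return $C_1\cup C_2$. Otherwise start with $C=C_1$; (randomized rounding) include each $E_j\in C_3$ in $C$ independently with probability $\lambda x_j^*$; (repairing) as long as some vertex is not fully covered by $C$, add to $C$ an arbitrary edge of $C_3$ not yet in $C$ that is incident to such a vertex; return $C$. *)

theory Defs
  imports "HOL-Probability.Probability"
begin

definition hypergraph :: "'a set \<Rightarrow> 'a set set \<Rightarrow> bool" where
  "hypergraph V E \<longleftrightarrow> finite V \<and> V \<noteq> {} \<and> (\<forall>e\<in>E. e \<subseteq> V)"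

definition degree :: "'a set set \<Rightarrow> 'a \<Rightarrow> nat" where
  "degree E v = card {e \<in> E. v \<in> e}"

definition max_degree :: "'a set \<Rightarrow> 'a set set \<Rightarrow> nat" where
  "max_degree V E = Max (degree E ` V)"

definition max_edge_size :: "'a set set \<Rightarrow> nat" where
  "max_edge_size E = Max (card ` E)"

definition fully_covered :: "('a \<Rightarrow> nat) \<Rightarrow> 'a set set \<Rightarrow> 'a \<Rightarrow> bool" where
  "fully_covered b C v \<longleftrightarrow> b v \<le> degree C v"

definition set_multicover :: "'a set \<Rightarrow> 'a set set \<Rightarrow> ('a \<Rightarrow> nat) \<Rightarrow> 'a set set \<Rightarrow> bool" where
  "set_multicover V E b C \<longleftrightarrow> C \<subseteq> E \<and> (\<forall>v\<in>V. fully_covered b C v)"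

definition Opt :: "'a set \<Rightarrow> 'a set set \<Rightarrow> ('a \<Rightarrow> nat) \<Rightarrow> nat" where
  "Opt V E b = Min (card ` {C. set_multicover V E b C})"

definition lp_feasible :: "'a set \<Rightarrow> 'a set set \<Rightarrow> ('a \<Rightarrow> nat) \<Rightarrow> ('a set \<Rightarrow> real) \<Rightarrow> bool" where
  "lp_feasible V E b x \<longleftrightarrow>
     (\<forall>v\<in>V. (\<Sum>e | e \<in> E \<and> v \<in> e. x e) \<ge> real (b v)) \<and> (\<forall>e\<in>E. x e \<in> {0..1})"

definition lp_optimal :: "'a set \<Rightarrow> 'a set set \<Rightarrow> ('a \<Rightarrow> nat) \<Rightarrow> ('a set \<Rightarrow> real) \<Rightarrow> bool" where
  "lp_optimal V E b x \<longleftrightarrow>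
     lp_feasible V E b x \<and> (\<forall>y. lp_feasible V E b y \<longrightarrow> (\<Sum>e\<in>E. x e) \<le> (\<Sum>e\<in>E. y e))"

definition lp_Opt :: "'a set \<Rightarrow> 'a set set \<Rightarrow> ('a \<Rightarrow> nat) \<Rightarrow> real" where
  "lp_Opt V E b = (INF x\<in>{x. lp_feasible V E b x}. \<Sum>e\<in>E. x e)"

definition min_demand :: "'a set \<Rightarrow> ('a \<Rightarrow> nat) \<Rightarrow> nat" where
  "min_demand V b = Min (b ` V)"

definition delta :: "'a set \<Rightarrow> 'a set set \<Rightarrow> ('a \<Rightarrow> nat) \<Rightarrow> real" where
  "delta V E b = real (max_degree V E) - real (min_demand V b) + 1"

definition lambda :: "'a set \<Rightarrow> 'a set set \<Rightarrow> ('a \<Rightarrow> nat) \<Rightarrow> real" where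
  "lambda V E b = (delta V E b + 1) / 2"

definition C1 :: "'a set \<Rightarrow> 'a set set \<Rightarrow> ('a \<Rightarrow> nat) \<Rightarrow> ('a set \<Rightarrow> real) \<Rightarrow> 'a set set" where
  "C1 V E b x = {e \<in> E. x e \<ge> 1 / lambda V E b}"

definition C2 :: "'a set \<Rightarrow> 'a set set \<Rightarrow> ('a \<Rightarrow> nat) \<Rightarrow> ('a set \<Rightarrow> real) \<Rightarrow> 'a set set" where
  "C2 V E b x = {e \<in> E. 1 / delta V E b \<le> x e \<and> x e < 1 / lambda V E b}"

definition C3 :: "'a set \<Rightarrow> 'a set set \<Rightarrow> ('a \<Rightarrow> nat) \<Rightarrow> ('a set \<Rightarrow> real) \<Rightarrow> 'a set set" where
  "C3 V E b x = {e \<in> E. 0 < x e \<and> x e < 1 / lambda V E b}"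

text \<open>On \<^const>\<open>C3\<close> the product \<open>\<lambda> x e\<close> lies in the open unit interval, so the truncation built into
  \<^const>\<open>bernoulli_pmf\<close> never takes effect.\<close>
definition rounding ::
  "'a set \<Rightarrow> 'a set set \<Rightarrow> ('a \<Rightarrow> nat) \<Rightarrow> ('a set \<Rightarrow> real) \<Rightarrow> 'a set set pmf" where
  "rounding V E b x =
     map_pmf (\<lambda>f. {e \<in> C3 V E b x. f e})
       (Pi_pmf (C3 V E b x) False (\<lambda>e. bernoulli_pmf (lambda V E b * x e)))"

definition repair_step ::
  "'a set \<Rightarrow> ('a \<Rightarrow> nat) \<Rightarrow> 'a set set \<Rightarrow> 'a set set \<Rightarrow> 'a set set \<Rightarrow> bool" where
  "repair_step V b D C C' \<longleftrightarrow>
     (\<exists>e\<in>D - C. (\<exists>v\<in>V. \<not> fully_covered b C v \<and> v \<in> e) \<and> C' = insert e C)"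

text \<open>A final state is one without a further step. It need not be a multicover by definition: the
  loop could also halt because no admissible edge is left.\<close>
definition repair_outcome ::
  "'a set \<Rightarrow> ('a \<Rightarrow> nat) \<Rightarrow> 'a set set \<Rightarrow> 'a set set \<Rightarrow> 'a set set \<Rightarrow> bool" where
  "repair_outcome V b D C C' \<longleftrightarrow>
     (repair_step V b D)\<^sup>*\<^sup>* C C' \<and> (\<nexists>C''. repair_step V b D C' C'')"

text \<open>The arbitrary choices of edges may be randomized and may depend on the rounded set and on all
  earlier choices, so a strategy is any kernel supported on possible outcomes of the loop.\<close>
definition repair_strategy ::
  "'a set \<Rightarrow> ('a \<Rightarrow> nat) \<Rightarrow> 'a set set \<Rightarrow> ('a set set \<Rightarrow> 'a set set pmf) \<Rightarrow> bool" where
  "repair_strategy V b D rep \<longleftrightarrow> (\<forall>C. \<forall>C'\<in>set_pmf (rep C). repair_outcome V b D C C')"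

lemma ex_repair_outcome:
  assumes "finite D"
  shows "\<exists>C'. repair_outcome V b D C C'"
proof (induction "card (D - C)" arbitrary: C rule: less_induct)
  case less
  show ?case
  proof (cases "\<exists>C'. repair_step V b D C C'")
    case True
    then obtain e where e: "e \<in> D - C" "repair_step V b D C (insert e C)"
      by (auto simp: repair_step_def)
    have "D - insert e C \<subset> D - C"
      using e(1) by auto
    then have "card (D - insert e C) < card (D - C)"
      using assms by (intro psubset_card_mono) auto
    from less[OF this] e(2) show ?thesis
      unfolding repair_outcome_def by (meson converse_rtranclp_into_rtranclp)
  qed (auto simp: repair_outcome_def)
qed

lemma ex_repair_strategy:
  assumes "finite D"
  shows "\<exists>rep. repair_strategy V b D rep"
proof -
  obtain r where "\<And>C. repair_outcome V b D C (r C)"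
    using ex_repair_outcome[OF assms] by metis
  then have "repair_strategy V b D (\<lambda>C. return_pmf (r C))"
    by (simp add: repair_strategy_def)
  then show ?thesis
    by blast
qed

definition set_b_multicover_alg ::
  "'a set \<Rightarrow> 'a set set \<Rightarrow> ('a \<Rightarrow> nat) \<Rightarrow> real \<Rightarrow> real \<Rightarrow> ('a set \<Rightarrow> real) \<Rightarrow>
   ('a set set \<Rightarrow> 'a set set pmf) \<Rightarrow> 'a set set pmf" where
  "set_b_multicover_alg V E b \<alpha> t x rep =
     (if real (card (C1 V E b x)) \<ge> \<alpha> * lp_Opt V E b
         \<or> t * real (card (C1 V E b x)) \<ge> real (card (C2 V E b x))
      then return_pmf (C1 V E b x \<union> C2 V E b x)
      else bind_pmf (rounding V E b x) (\<lambda>R. rep (C1 V E b x \<union> R)))"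

end

theory Submission
  imports Defs
begin

text \<open>
  The parameter \<open>\<lambda> = (\<delta> + 1) / 2\<close> is large enough that, by a pigeonhole argument, the edges of weight
  at least \<open>1 / \<lambda>\<close> already cover every vertex \<open>v\<close> all but once (\<open>demand_le_degree_C1\<close>). Hence after
  rounding every vertex misses at most one edge, and the repair loop adds at most as many edges as there
  are deficient vertices, whatever choices it makes (\<open>card_repair_steps_le\<close>). It can only halt at a
  multicover because the edges of positive weight form one. The returned set therefore has
  at most \<open>|C1| + |R| + U\<close> edges, where \<open>R\<close> is the random set of rounded edges and \<open>U\<close> the number of
  deficient vertices after rounding.

  Let \<open>K\<close> be the optimal value of the linear program, and \<open>\<mu>\<close> the mean of \<open>|R|\<close>. Edges in \<open>C1\<close> are
  paid for by their weight scaled up by \<open>\<lambda>\<close>, so \<open>|C1| + \<mu> \<le> \<lambda> K\<close>. The target splits as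
  \<open>(15 \<delta> + 14) / 20 = \<lambda> + 2/5 \<lambda> + \<delta>/20\<close>: the algorithm can fail only if \<open>|R|\<close> exceeds its mean by at least
  \<open>2/5 \<lambda> K\<close> or \<open>U\<close> is at least \<open>\<delta> K / 20\<close>.

  \<^item> \<open>|R|\<close> is a sum of independent indicators, so the Chernoff bound
    \<open>prob_card_random_subset_ge_le\<close> applies. The hypothesis \<open>73 |C1| < |C2|\<close> forces
    \<open>|C2| \<ge> 74\<close>, hence \<open>\<delta> K \<ge> 74\<close> and \<open>\<lambda> K \<ge> 37\<close>, which brings the failure probability down
    to \<open>exp (- 2) \<le> 1/5\<close>.

  \<^item> A vertex not covered by \<open>C1\<close> alone receives at least one unit of weight from the
    edges that are rounded, and so stays deficient with probability at most \<open>exp (- \<lambda>)\<close>. Counting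
    incidences with \<open>C1\<close>, the hypothesis \<open>|C1| < \<alpha> K\<close> bounds the number of vertices by
    \<open>\<delta> exp (\<delta>/4) K / 47\<close>, and Markov's inequality makes the failure probability at most
    \<open>20/47 exp (- \<delta>/4 - 1/2) \<le> 10/47\<close>, as \<open>\<delta> \<ge> 2\<close>.

  The two failure probabilities add up to less than \<open>0.47\<close>, and \<open>K \<le> Opt\<close> turns the bound in terms
  of \<open>K\<close> into the claimed one.
\<close>

section \<open>Random subsets\<close>

definition random_subset :: "'a set \<Rightarrow> ('a \<Rightarrow> real) \<Rightarrow> 'a set pmf" where
  "random_subset A p = map_pmf (\<lambda>f. {a \<in> A. f a}) (Pi_pmf A False (\<lambda>a. bernoulli_pmf (p a)))"

lemma set_random_subset: "set_pmf (random_subset A p) \<subseteq> Pow A"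
  by (auto simp: random_subset_def)

lemma finite_set_random_subset: "finite A \<Longrightarrow> finite (set_pmf (random_subset A p))"
  using set_random_subset[of A p] by (meson finite_Pow_iff finite_subset)

lemma prob_pmf_mono:
  assumes "\<And>x. x \<in> set_pmf M \<Longrightarrow> x \<in> A \<Longrightarrow> x \<in> B"
  shows "measure_pmf.prob M A \<le> measure_pmf.prob M B"
  using assms by (intro measure_pmf.finite_measure_mono_AE) (auto simp: AE_measure_pmf_iff)

lemma prob_random_subset_disjoint_le:
  assumes "finite A" "S \<subseteq> A" and p: "\<And>a. a \<in> A \<Longrightarrow> 0 \<le> p a \<and> p a \<le> 1"
  shows "measure_pmf.prob (random_subset A p) {R. R \<inter> S = {}} \<le> exp (- (\<Sum>a\<in>S. p a))"
proof -
  have "measure_pmf.prob (random_subset A p) {R. R \<inter> S = {}} =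
      measure_pmf.prob (Pi_pmf A False (\<lambda>a. bernoulli_pmf (p a)))
        (Pi A (\<lambda>a. if a \<in> S then {False} else UNIV))"
    using assms(2) unfolding random_subset_def measure_map_pmf
    by (intro arg_cong[where f = "measure_pmf.prob _"]) (auto simp: Pi_iff split: if_splits)
  also have "\<dots> = (\<Prod>a\<in>A. if a \<in> S then 1 - p a else 1)"
    unfolding measure_Pi_pmf_Pi[OF assms(1)]
    by (intro prod.cong refl) (use p in \<open>auto simp: measure_pmf_single\<close>)
  also have "\<dots> = (\<Prod>a\<in>S. 1 - p a)"
    using assms(1,2) by (simp add: prod.If_cases Int_absorb1)
  also have "\<dots> \<le> (\<Prod>a\<in>S. exp (- p a))"
  proof (intro prod_mono conjI)
    fix a assume "a \<in> S"
    then show "0 \<le> 1 - p a"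
      using p assms(2) by (simp add: subset_iff)
    show "1 - p a \<le> exp (- p a)"
      using exp_ge_add_one_self[of "- p a"] by simp
  qed
  also have "\<dots> = exp (- (\<Sum>a\<in>S. p a))"
    using assms(1,2) by (simp add: exp_sum finite_subset sum_negf[symmetric])
  finally show ?thesis .
qed

text \<open>The Chernoff bound: the moment generating function of the size factorizes over the
  independent choices, and Markov's inequality is applied to it.\<close>
lemma prob_card_random_subset_ge_le:
  assumes "finite A" and p: "\<And>a. a \<in> A \<Longrightarrow> 0 \<le> p a \<and> p a \<le> 1" and "0 \<le> s"
  shows "measure_pmf.prob (random_subset A p) {R. c \<le> real (card R)} \<le>
    exp ((exp s - 1) * (\<Sum>a\<in>A. p a) - s * c)"
proof -
  let ?P = "Pi_pmf A False (\<lambda>a. bernoulli_pmf (p a))"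
  let ?M = "random_subset A p"
  have "measure_pmf.expectation ?M (\<lambda>R. exp (s * real (card R))) =
      measure_pmf.expectation ?P (\<lambda>f. \<Prod>a\<in>A. exp (s * of_bool (f a)))"
    using assms(1) by (auto simp: random_subset_def exp_sum[symmetric] sum_distrib_left[symmetric]
        Int_def intro!: Bochner_Integration.integral_cong)
  also have "\<dots> = (\<Prod>a\<in>A. measure_pmf.expectation (bernoulli_pmf (p a)) (\<lambda>y. exp (s * of_bool y)))"
    using assms(1) by (intro expectation_prod_Pi_pmf) (auto intro: integrable_measure_pmf_finite)
  also have "\<dots> = (\<Prod>a\<in>A. 1 + (exp s - 1) * p a)"
    by (intro prod.cong refl) (use p in \<open>auto simp: algebra_simps\<close>)
  also have "\<dots> \<le> (\<Prod>a\<in>A. exp ((exp s - 1) * p a))"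
    using p \<open>0 \<le> s\<close> by (intro prod_mono conjI exp_ge_add_one_self) auto
  also have "\<dots> = exp ((exp s - 1) * (\<Sum>a\<in>A. p a))"
    using assms(1) by (simp add: exp_sum sum_distrib_left)
  finally have mgf: "measure_pmf.expectation ?M (\<lambda>R. exp (s * real (card R)))
      \<le> exp ((exp s - 1) * (\<Sum>a\<in>A. p a))" .
  have "measure_pmf.prob ?M {R. c \<le> real (card R)} \<le>
      measure_pmf.prob ?M {R \<in> space ?M. exp (s * c) \<le> exp (s * real (card R))}"
    using \<open>0 \<le> s\<close> by (intro prob_pmf_mono) (auto intro: mult_left_mono)
  also have "\<dots> \<le> measure_pmf.expectation ?M (\<lambda>R. exp (s * real (card R))) / exp (s * c)"
    by (intro integral_Markov_inequality_measure[where A = "{}"])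
      (use assms(1) in \<open>auto intro!: integrable_measure_pmf_finite finite_set_random_subset\<close>)
  also have "\<dots> \<le> exp ((exp s - 1) * (\<Sum>a\<in>A. p a)) / exp (s * c)"
    using mgf by (intro divide_right_mono) auto
  finally show ?thesis
    by (simp add: exp_diff)
qed

text \<open>Markov's inequality for the number of events that occur; its mean is the sum of their
  probabilities, however dependent they are.\<close>
lemma prob_card_events_ge_le:
  assumes "finite V" "0 < (c::real)"
    and q: "\<And>v. v \<in> V \<Longrightarrow> measure_pmf.prob M {R. Q v R} \<le> q"
  shows "measure_pmf.prob M {R. c \<le> real (card {v \<in> V. Q v R})} \<le> real (card V) * q / c"
proof -
  have integrable: "integrable M (indicator A :: _ \<Rightarrow> real)" for A
    by (rule integrable_real_indicator) (simp_all add: measure_pmf.emeasure_eq_measure)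
  have count: "real (card {v \<in> V. Q v R}) = (\<Sum>v\<in>V. indicator {R. Q v R} R)" for R
    using assms(1) by (simp add: indicator_def Int_def)
  have "measure_pmf.prob M {R. c \<le> real (card {v \<in> V. Q v R})} =
      measure_pmf.prob M {R \<in> space M. c \<le> (\<Sum>v\<in>V. indicator {R. Q v R} R)}"
    by (simp add: count)
  also have "\<dots> \<le> measure_pmf.expectation M (\<lambda>R. \<Sum>v\<in>V. indicator {R. Q v R} R) / c"
    by (intro integral_Markov_inequality_measure[where A = "{}"])
      (use assms(2) integrable in \<open>auto intro!: sum_nonneg simp del: sum_indicator_eq_card\<close>)
  also have "\<dots> = (\<Sum>v\<in>V. measure_pmf.prob M {R. Q v R}) / c"
    by (subst Bochner_Integration.integral_sum) (use integrable in auto)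
  also have "\<dots> \<le> real (card V) * q / c"
    using sum_bounded_above[of V "\<lambda>v. measure_pmf.prob M {R. Q v R}" q] q assms(2)
    by (simp add: divide_right_mono)
  finally show ?thesis .
qed

text \<open>Transfers a bound on the rounding to the whole algorithm: whatever the second stage \<open>f\<close> does, it
  can reach \<open>A\<close> only from \<open>B\<close>.\<close>
lemma prob_bind_pmf_le:
  assumes "\<And>x y. x \<in> set_pmf M \<Longrightarrow> y \<in> set_pmf (f x) \<Longrightarrow> y \<in> A \<Longrightarrow> x \<in> B"
  shows "measure_pmf.prob (bind_pmf M f) A \<le> measure_pmf.prob M B"
proof -
  have "emeasure (f x) A \<le> indicator B x" if "x \<in> set_pmf M" for x
  proof (cases "x \<in> B")
    case False
    with assms[OF that] have "measure_pmf.prob (f x) A = 0"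
      by (auto simp: measure_pmf_zero_iff)
    then show ?thesis
      by (simp add: measure_pmf.emeasure_eq_measure)
  qed (simp add: measure_pmf.emeasure_le_1)
  then have "emeasure (bind_pmf M f) A \<le> emeasure M B"
    by (auto simp: AE_measure_pmf_iff simp flip: nn_integral_indicator
        intro!: nn_integral_mono_AE)
  then show ?thesis
    by (simp add: measure_pmf.emeasure_eq_measure)
qed

section \<open>The repair loop\<close>

lemma degree_mono: "C \<subseteq> D \<Longrightarrow> finite D \<Longrightarrow> degree C v \<le> degree D v"
  unfolding degree_def by (intro card_mono) auto

lemma degree_insert:
  assumes "finite C" "e \<notin> C"
  shows "degree (insert e C) v = degree C v + (if v \<in> e then 1 else 0)"
proof -
  have "{e' \<in> insert e C. v \<in> e'} = (if v \<in> e then insert e {e' \<in> C. v \<in> e'} else {e' \<in> C. v \<in> e'})"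
    by auto
  with assms show ?thesis
    by (simp add: degree_def)
qed

text \<open>When every vertex misses at most one edge, each inserted edge settles the deficient vertex that
  justified it for good; so the initially deficient vertices pay for all insertions.\<close>
lemma card_repair_steps_le:
  assumes "(repair_step V b D)\<^sup>*\<^sup>* C C'" "finite C" "finite V"
    and "\<And>v. v \<in> V \<Longrightarrow> b v \<le> degree C v + 1"
  shows "card C' \<le> card C + card {v \<in> V. \<not> fully_covered b C v}"
  using assms
proof (induction rule: converse_rtranclp_induct)
  case base
  then show ?case by simp
next
  case (step C C'')
  from step.hyps(1) obtain e v where e: "e \<in> D - C" "v \<in> V" "\<not> fully_covered b C v" "v \<in> e"
    "C'' = insert e C"
    unfolding repair_step_def by blast
  have deg: "degree (insert e C) u = degree C u + (if u \<in> e then 1 else 0)" for u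
    using degree_insert[of C e u] e step.prems by simp
  have "card C' \<le> card C'' + card {u \<in> V. \<not> fully_covered b C'' u}"
  proof (intro step.IH)
    fix u assume "u \<in> V"
    then show "b u \<le> degree C'' u + 1"
      using step.prems(3)[of u] by (simp add: e(5) deg)
  qed (use step.prems e(5) in auto)
  moreover have "card {u \<in> V. \<not> fully_covered b C'' u} < card {u \<in> V. \<not> fully_covered b C u}"
  proof (rule psubset_card_mono)
    have "v \<notin> {u \<in> V. \<not> fully_covered b C'' u}"
      using step.prems(3)[OF e(2)] e(4) by (simp add: fully_covered_def e(5) deg)
    moreover have "v \<in> {u \<in> V. \<not> fully_covered b C u}"
      using e by simp
    moreover have "{u \<in> V. \<not> fully_covered b C'' u} \<subseteq> {u \<in> V. \<not> fully_covered b C u}"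
      by (auto simp: fully_covered_def e(5) deg)
    ultimately show "{u \<in> V. \<not> fully_covered b C'' u} \<subset> {u \<in> V. \<not> fully_covered b C u}"
      by blast
  qed (use step.prems in auto)
  ultimately show ?case
    using e step.prems by simp
qed

lemma repair_steps_subset:
  assumes "(repair_step V b D)\<^sup>*\<^sup>* C C'"
  shows "C \<subseteq> C' \<and> C' \<subseteq> C \<union> D"
  using assms by (induction rule: rtranclp_induct) (auto simp: repair_step_def)

text \<open>The loop can only halt at a multicover: at a deficient vertex, an edge of the pool \<open>D\<close> is still
  unused, since all edges together cover that vertex.\<close>
lemma repair_outcome_multicover:
  assumes "repair_outcome V b D C C'" "finite (C \<union> D)" "C \<union> D \<subseteq> E"
    and "\<And>v. v \<in> V \<Longrightarrow> fully_covered b (C \<union> D) v"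
  shows "set_multicover V E b C'"
proof -
  from assms(1) have C': "C \<subseteq> C'" "C' \<subseteq> C \<union> D" and halt: "\<nexists>C''. repair_step V b D C' C''"
    using repair_steps_subset[of V b D C C'] by (auto simp: repair_outcome_def)
  have "fully_covered b C' v" if "v \<in> V" for v
  proof (rule ccontr)
    assume v: "\<not> fully_covered b C' v"
    have "\<not> {e \<in> C \<union> D. v \<in> e} \<subseteq> C'"
    proof
      assume "{e \<in> C \<union> D. v \<in> e} \<subseteq> C'"
      then have "{e \<in> C \<union> D. v \<in> e} = {e \<in> C'. v \<in> e}"
        using C' by auto
      with v assms(4)[OF that] show False
        by (simp add: fully_covered_def degree_def)
    qed
    then obtain e where "e \<in> D - C'" "v \<in> e"
      using C' by auto
    with v that halt show False
      unfolding repair_step_def by blast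
  qed
  with C' assms(3) show ?thesis
    by (auto simp: set_multicover_def)
qed

section \<open>Consequences of LP feasibility\<close>

locale fractional_multicover =
  fixes V :: "'a set" and E :: "'a set set" and b :: "'a \<Rightarrow> nat" and x :: "'a set \<Rightarrow> real"
  assumes hypergraph: "hypergraph V E"
    and demand_ge_2: "v \<in> V \<Longrightarrow> b v \<ge> 2"
    and demand_le_degree: "v \<in> V \<Longrightarrow> b v \<le> degree E v"
    and feasible: "lp_feasible V E b x"
begin

abbreviation "\<delta> \<equiv> delta V E b"
abbreviation "\<Lambda> \<equiv> lambda V E b"
abbreviation "F1 \<equiv> C1 V E b x"
abbreviation "F2 \<equiv> C2 V E b x"
abbreviation "F3 \<equiv> C3 V E b x"

lemma finite_V: "finite V" and V_nonempty: "V \<noteq> {}" and edge_subset: "e \<in> E \<Longrightarrow> e \<subseteq> V"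
  using hypergraph by (auto simp: hypergraph_def)

lemma finite_E: "finite E"
  using finite_V edge_subset by (intro finite_subset[of E "Pow V"]) auto

lemma x_range: "e \<in> E \<Longrightarrow> 0 \<le> x e \<and> x e \<le> 1"
  using feasible by (auto simp: lp_feasible_def)

lemma x_covers: "v \<in> V \<Longrightarrow> real (b v) \<le> (\<Sum>e | e \<in> E \<and> v \<in> e. x e)"
  using feasible by (auto simp: lp_feasible_def)

lemma degree_le_delta:
  assumes "v \<in> V"
  shows "real (degree E v) + 1 \<le> \<delta> + real (b v)"
proof -
  have "degree E v \<le> max_degree V E" "min_demand V b \<le> b v"
    using assms finite_V by (auto simp: max_degree_def min_demand_def)
  then show ?thesis
    by (simp add: delta_def)
qed

lemma delta_ge_1: "1 \<le> \<delta>"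
proof -
  obtain v where "v \<in> V"
    using V_nonempty by auto
  then show ?thesis
    using degree_le_delta[of v] demand_le_degree[of v] by linarith
qed

lemma lambda_ge_1: "1 \<le> \<Lambda>"
  using delta_ge_1 by (simp add: lambda_def)

lemma min_demand_ge_2: "2 \<le> min_demand V b"
  using finite_V V_nonempty demand_ge_2 by (simp add: min_demand_def)

lemma min_demand_le: "v \<in> V \<Longrightarrow> min_demand V b \<le> b v"
  using finite_V by (simp add: min_demand_def)

lemma finite_F: "finite F1" "finite F2" "finite F3"
  and F_subset: "F1 \<subseteq> E" "F2 \<subseteq> E" "F3 \<subseteq> E"
  and F_disjoint: "F1 \<inter> F3 = {}"
  using finite_E by (auto simp: C1_def C2_def C3_def)

text \<open>Otherwise all but \<open>b v - 2\<close> of the edges at \<open>v\<close> have weight below \<open>1 / \<lambda> = 2 / (\<delta> + 1)\<close>. As at most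
  \<open>\<delta> + 1\<close> edges are left, the total weight at \<open>v\<close> is less than \<open>(b v - 2) + 2\<close>, which contradicts
  feasibility. This is what singles out the value of \<open>\<lambda>\<close>.\<close>
lemma demand_le_degree_C1:
  assumes v: "v \<in> V"
  shows "b v \<le> degree F1 v + 1"
proof (rule ccontr)
  assume "\<not> ?thesis"
  then have few: "real (degree F1 v) + 2 \<le> real (b v)"
    by simp
  have two_lambda: "2 * \<Lambda> = \<delta> + 1"
    by (simp add: lambda_def)
  let ?I = "{e \<in> E. v \<in> e}" and ?H = "{e \<in> F1. v \<in> e}"
  have HI: "?H \<subseteq> ?I" "finite ?I"
    using F_subset finite_E by auto
  have card_diff: "real (card (?I - ?H)) = real (degree E v) - real (degree F1 v)"
    using HI by (simp add: card_Diff_subset finite_subset degree_def card_mono of_nat_diff)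
  have "?I - ?H \<noteq> {}"
  proof
    assume "?I - ?H = {}"
    with card_diff have "degree E v = degree F1 v"
      by (metis card.empty eq_iff_diff_eq_0 of_nat_0 of_nat_eq_iff)
    with few demand_le_degree[OF v] show False
      by simp
  qed
  have "real (b v) \<le> (\<Sum>e\<in>?I. x e)"
    using x_covers[OF v] .
  also have "\<dots> = (\<Sum>e\<in>?H. x e) + (\<Sum>e\<in>?I - ?H. x e)"
    using sum.subset_diff[OF HI] by (simp add: add.commute)
  also have "(\<Sum>e\<in>?H. x e) \<le> real (degree F1 v)"
    using sum_bounded_above[of ?H x 1] x_range HI by (auto simp: degree_def)
  also have "(\<Sum>e\<in>?I - ?H. x e) < (\<Sum>e\<in>?I - ?H. 1 / \<Lambda>)"
    by (intro sum_strict_mono) (use HI \<open>?I - ?H \<noteq> {}\<close> in \<open>auto simp: C1_def\<close>)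
  also have "(\<Sum>e\<in>?I - ?H. 1 / \<Lambda>) = (real (degree E v) - real (degree F1 v)) * (1 / \<Lambda>)"
    by (simp add: card_diff)
  finally have "real (b v) - real (degree F1 v) < (real (degree E v) - real (degree F1 v)) * (1 / \<Lambda>)"
    by simp
  then have "(real (b v) - real (degree F1 v)) * \<Lambda> < real (degree E v) - real (degree F1 v)"
    using lambda_ge_1 by (simp add: field_simps)
  also have "\<dots> \<le> 2 * \<Lambda> + (real (b v) - real (degree F1 v) - 2)"
    using degree_le_delta[OF v] two_lambda by linarith
  also have "\<dots> \<le> 2 * \<Lambda> + (real (b v) - real (degree F1 v) - 2) * \<Lambda>"
    using few lambda_ge_1 mult_left_mono[of 1 \<Lambda> "real (b v) - real (degree F1 v) - 2"] by simp
  finally show False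
    by (simp add: algebra_simps)
qed

lemma fully_covered_C1_C3:
  assumes v: "v \<in> V"
  shows "fully_covered b (F1 \<union> F3) v"
proof -
  have "real (b v) \<le> (\<Sum>e | e \<in> E \<and> v \<in> e. x e)"
    using x_covers[OF v] .
  also have "\<dots> = (\<Sum>e | e \<in> F1 \<union> F3 \<and> v \<in> e. x e)"
  proof (rule sum.mono_neutral_right)
    show "\<forall>e\<in>{e. e \<in> E \<and> v \<in> e} - {e. e \<in> F1 \<union> F3 \<and> v \<in> e}. x e = 0"
      using x_range by (force simp: C1_def C3_def)
  qed (use finite_E F_subset in auto)
  also have "\<dots> \<le> real (degree (F1 \<union> F3) v)"
    using sum_bounded_above[of "{e. e \<in> F1 \<union> F3 \<and> v \<in> e}" x 1] x_range F_subset
    by (auto simp: degree_def)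
  finally show ?thesis
    by (simp add: fully_covered_def)
qed

text \<open>Edges of \<^const>\<open>C1\<close> carry weight at most \<open>1\<close> each, so a vertex that lies in fewer than \<open>b v\<close> of
  them receives at least one unit of weight from \<^const>\<open>C3\<close>.\<close>
lemma C3_weight_ge_1:
  assumes v: "v \<in> V" and "\<not> fully_covered b F1 v"
  shows "1 \<le> (\<Sum>e | e \<in> F3 \<and> v \<in> e. x e)"
proof -
  have "real (b v) \<le> (\<Sum>e | e \<in> E \<and> v \<in> e. x e)"
    using x_covers[OF v] .
  also have "\<dots> = (\<Sum>e\<in>{e. e \<in> F1 \<and> v \<in> e} \<union> {e. e \<in> F3 \<and> v \<in> e}. x e)"
  proof (rule sum.mono_neutral_right)
    show "\<forall>e\<in>{e. e \<in> E \<and> v \<in> e} - ({e. e \<in> F1 \<and> v \<in> e} \<union> {e. e \<in> F3 \<and> v \<in> e}). x e = 0"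
      using x_range by (force simp: C1_def C3_def)
  qed (use finite_E F_subset in auto)
  also have "\<dots> = (\<Sum>e | e \<in> F1 \<and> v \<in> e. x e) + (\<Sum>e | e \<in> F3 \<and> v \<in> e. x e)"
    using finite_F F_disjoint by (intro sum.union_disjoint) auto
  also have "(\<Sum>e | e \<in> F1 \<and> v \<in> e. x e) \<le> real (degree F1 v)"
    using sum_bounded_above[of "{e. e \<in> F1 \<and> v \<in> e}" x 1] x_range F_subset
    by (auto simp: degree_def)
  finally show ?thesis
    using assms(2) by (simp add: fully_covered_def)
qed

text \<open>Double counting of the incidences between vertices and \<^const>\<open>C1\<close>.\<close>
lemma card_V_le:
  "(real (min_demand V b) - 1) * real (card V) \<le> real (max_edge_size E) * real (card F1)"
proof -
  have "(min_demand V b - 1) * card V \<le> (\<Sum>v\<in>V. degree F1 v)"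
    using sum_bounded_below[of V "min_demand V b - 1" "degree F1"]
      demand_le_degree_C1 min_demand_le by (simp add: le_diff_conv mult.commute)(meson le_trans)
  also have "\<dots> = (\<Sum>e\<in>F1. card {v \<in> V. v \<in> e})"
    unfolding degree_def by (rule sum_multicount_gen) (use finite_V finite_F in auto)
  also have "\<dots> \<le> card F1 * max_edge_size E"
  proof -
    have "card {v \<in> V. v \<in> e} \<le> max_edge_size E" if "e \<in> F1" for e
    proof -
      have "{v \<in> V. v \<in> e} = e"
        using that edge_subset F_subset by auto
      then show ?thesis
        using that F_subset finite_E by (auto simp: max_edge_size_def)
    qed
    then show ?thesis
      using sum_bounded_above[of F1 "\<lambda>e. card {v \<in> V. v \<in> e}" "max_edge_size E"] by simp
  qed
  finally have "real ((min_demand V b - 1) * card V) \<le> real (card F1 * max_edge_size E)"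
    by (rule of_nat_mono)
  then show ?thesis
    using min_demand_ge_2 by (simp add: of_nat_diff mult.commute)
qed

lemma card_C1_pos: "0 < card F1"
proof -
  obtain v where "v \<in> V"
    using V_nonempty by auto
  then have "degree F1 v \<noteq> 0"
    using demand_le_degree_C1[of v] demand_ge_2[of v] by linarith
  then have "F1 \<noteq> {}"
    by (auto simp: degree_def)
  then show ?thesis
    using finite_F by (simp add: card_gt_0_iff)
qed

text \<open>Each edge of \<^const>\<open>C1\<close> is paid for by its own weight scaled up by \<open>\<lambda>\<close>.\<close>
lemma card_C1_plus_mean_le: "real (card F1) + \<Lambda> * (\<Sum>e\<in>F3. x e) \<le> \<Lambda> * (\<Sum>e\<in>E. x e)"
proof -
  have "real (card F1) = (\<Sum>e\<in>F1. \<Lambda> * (1 / \<Lambda>))"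
    using lambda_ge_1 by simp
  also have "\<dots> \<le> (\<Sum>e\<in>F1. \<Lambda> * x e)"
    using lambda_ge_1 by (intro sum_mono mult_left_mono) (auto simp: C1_def)
  finally have "real (card F1) + \<Lambda> * (\<Sum>e\<in>F3. x e) \<le> \<Lambda> * (\<Sum>e\<in>F1 \<union> F3. x e)"
    using finite_F F_disjoint by (simp add: sum.union_disjoint sum_distrib_left algebra_simps)
  also have "\<dots> \<le> \<Lambda> * (\<Sum>e\<in>E. x e)"
    using lambda_ge_1 finite_E F_subset x_range by (intro mult_left_mono sum_mono2) auto
  finally show ?thesis .
qed

lemma card_C2_le: "real (card F2) \<le> \<delta> * (\<Sum>e\<in>E. x e)"
proof -
  have "real (card F2) = \<delta> * (\<Sum>e\<in>F2. 1 / \<delta>)"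
    using delta_ge_1 by simp
  also have "\<dots> \<le> \<delta> * (\<Sum>e\<in>E. x e)"
    using delta_ge_1 finite_E F_subset x_range
    by (intro mult_left_mono order.trans[OF sum_mono sum_mono2]) (auto simp: C2_def)
  finally show ?thesis .
qed

section \<open>The rounding step\<close>

lemma rounding_eq: "rounding V E b x = random_subset F3 (\<lambda>e. \<Lambda> * x e)"
  by (simp add: rounding_def random_subset_def)

lemma rounding_prob_range: "e \<in> F3 \<Longrightarrow> 0 \<le> \<Lambda> * x e \<and> \<Lambda> * x e \<le> 1"
  using lambda_ge_1 by (auto simp: C3_def field_simps)

lemma set_rounding: "R \<in> set_pmf (rounding V E b x) \<Longrightarrow> R \<subseteq> F3"
  using set_random_subset[of F3] by (auto simp: rounding_eq)

text \<open>A vertex that is not covered by \<^const>\<open>C1\<close> stays deficient only if none of its edges is rounded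
  up; by \<open>C3_weight_ge_1\<close> their selection probabilities add up to at least \<open>\<lambda>\<close>.\<close>
lemma prob_not_fully_covered_le:
  assumes v: "v \<in> V"
  shows "measure_pmf.prob (rounding V E b x) {R. \<not> fully_covered b (F1 \<union> R) v} \<le> exp (- \<Lambda>)"
proof (cases "fully_covered b F1 v")
  case True
  have "fully_covered b (F1 \<union> R) v" if "R \<in> set_pmf (rounding V E b x)" for R
    using True degree_mono[of F1 "F1 \<union> R" v] finite_F set_rounding[OF that]
    by (auto simp: fully_covered_def finite_subset)
  then have "measure_pmf.prob (rounding V E b x) {R. \<not> fully_covered b (F1 \<union> R) v} = 0"
    by (auto simp: measure_pmf_zero_iff)
  then show ?thesis
    by simp
next
  case False
  let ?S = "{e. e \<in> F3 \<and> v \<in> e}"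
  have hit: "fully_covered b (F1 \<union> R) v" if R: "R \<subseteq> F3" and e: "e \<in> R" "v \<in> e" for R e
  proof -
    have "e \<notin> F1"
      using R e(1) F_disjoint by auto
    then have "b v \<le> degree (insert e F1) v"
      using demand_le_degree_C1[OF v] degree_insert[of F1 e v] finite_F e(2) by simp
    also have "\<dots> \<le> degree (F1 \<union> R) v"
      using R e finite_F by (intro degree_mono) (auto simp: finite_subset)
    finally show ?thesis
      by (simp add: fully_covered_def)
  qed
  have "measure_pmf.prob (rounding V E b x) {R. \<not> fully_covered b (F1 \<union> R) v} \<le>
      measure_pmf.prob (rounding V E b x) {R. R \<inter> ?S = {}}"
    using hit set_rounding by (intro prob_pmf_mono) blast
  also have "\<dots> \<le> exp (- (\<Sum>e\<in>?S. \<Lambda> * x e))"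
    unfolding rounding_eq using finite_F rounding_prob_range
    by (intro prob_random_subset_disjoint_le) auto
  also have "\<dots> \<le> exp (- \<Lambda>)"
    using C3_weight_ge_1[OF v False] lambda_ge_1 by (simp add: sum_distrib_left[symmetric])
  finally show ?thesis .
qed

lemma card_repaired_le:
  assumes "R \<in> set_pmf (rounding V E b x)" "repair_outcome V b F3 (F1 \<union> R) C"
  shows "card C \<le> card F1 + card R + card {v \<in> V. \<not> fully_covered b (F1 \<union> R) v}"
proof -
  have fin: "finite (F1 \<union> R)"
    using finite_F set_rounding[OF assms(1)] by (auto simp: finite_subset)
  have "card C \<le> card (F1 \<union> R) + card {v \<in> V. \<not> fully_covered b (F1 \<union> R) v}"
  proof (rule card_repair_steps_le)
    fix v assume "v \<in> V"
    then show "b v \<le> degree (F1 \<union> R) v + 1"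
      using demand_le_degree_C1[of v] degree_mono[of F1 "F1 \<union> R" v] fin by simp
  qed (use assms(2) fin finite_V in \<open>auto simp: repair_outcome_def\<close>)
  then show ?thesis
    using card_Un_le[of F1 R] by linarith
qed

lemma repaired_multicover:
  assumes "R \<in> set_pmf (rounding V E b x)" "repair_outcome V b F3 (F1 \<union> R) C"
  shows "set_multicover V E b C"
proof (rule repair_outcome_multicover[OF assms(2)])
  have "F1 \<union> R \<union> F3 = F1 \<union> F3"
    using set_rounding[OF assms(1)] by auto
  then show "finite (F1 \<union> R \<union> F3)" "F1 \<union> R \<union> F3 \<subseteq> E"
    "\<And>v. v \<in> V \<Longrightarrow> fully_covered b (F1 \<union> R \<union> F3) v"
    using finite_F F_subset fully_covered_C1_C3 by auto
qed

end

section \<open>The approximation guarantee\<close>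

lemma lp_Opt_eq:
  assumes "lp_optimal V E b x"
  shows "lp_Opt V E b = (\<Sum>e\<in>E. x e)"
  unfolding lp_Opt_def using assms
  by (intro cInf_eq_minimum) (auto simp: lp_optimal_def)

text \<open>The indicator function of a multicover is LP feasible.\<close>
lemma lp_Opt_le_Opt:
  assumes "hypergraph V E" "\<And>v. v \<in> V \<Longrightarrow> b v \<le> degree E v" "lp_optimal V E b x"
  shows "lp_Opt V E b \<le> real (Opt V E b)"
proof -
  have finE: "finite E"
    using assms(1) by (intro finite_subset[of E "Pow V"]) (auto simp: hypergraph_def)
  let ?S = "{C. set_multicover V E b C}"
  have "finite ?S"
    using finE by (intro finite_subset[of ?S "Pow E"]) (auto simp: set_multicover_def)
  moreover have "E \<in> ?S"
    using assms(2) by (auto simp: set_multicover_def fully_covered_def)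
  ultimately have "Opt V E b \<in> card ` ?S"
    unfolding Opt_def by (intro Min_in) auto
  then obtain C where C: "set_multicover V E b C" "Opt V E b = card C"
    by auto
  have CE: "C \<subseteq> E"
    using C by (simp add: set_multicover_def)
  have "lp_feasible V E b (\<lambda>e. of_bool (e \<in> C))"
    unfolding lp_feasible_def
  proof (intro conjI ballI)
    fix v assume "v \<in> V"
    then have "b v \<le> degree C v"
      using C by (auto simp: set_multicover_def fully_covered_def)
    moreover have "{e. e \<in> E \<and> v \<in> e} \<inter> {e. e \<in> C} = {e \<in> C. v \<in> e}"
      using CE by auto
    ultimately show "real (b v) \<le> (\<Sum>e | e \<in> E \<and> v \<in> e. of_bool (e \<in> C))"
      using finE by (simp add: degree_def)
  qed auto
  then have "(\<Sum>e\<in>E. x e) \<le> (\<Sum>e\<in>E. of_bool (e \<in> C))"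
    using assms(3) by (auto simp: lp_optimal_def)
  also have "\<dots> = real (card C)"
    using finE CE by (simp add: Int_absorb1)
  finally show ?thesis
    using C(2) lp_Opt_eq[OF assms(3)] by simp
qed

theorem theorem5:
  fixes V :: "'a set" and E :: "'a set set" and b :: "'a \<Rightarrow> nat"
    and x :: "'a set \<Rightarrow> real" and rep :: "'a set set \<Rightarrow> 'a set set pmf"
    and \<alpha> t \<delta> :: real
  assumes "hypergraph V E"
    and "\<And>v. v \<in> V \<Longrightarrow> b v \<ge> 2"
    and "\<And>v. v \<in> V \<Longrightarrow> degree E v \<ge> b v"
    and "\<delta> = delta V E b"
    and "\<alpha> = (real (min_demand V b) - 1) * \<delta> * exp (\<delta> / 4) / (47 * real (max_edge_size E))"
    and "t = 73"
    and "lp_optimal V E b x"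
    and "repair_strategy V b (C3 V E b x) rep"
    and "real (card (C1 V E b x)) < \<alpha> * lp_Opt V E b"
    and "t * real (card (C1 V E b x)) < real (card (C2 V E b x))"
  shows "(\<forall>C\<in>set_pmf (set_b_multicover_alg V E b \<alpha> t x rep). set_multicover V E b C) \<and>
    measure_pmf.prob (set_b_multicover_alg V E b \<alpha> t x rep)
      {C. real (card C) < (15 * \<delta> + 14) / 20 * real (Opt V E b)} > 0.53"
proof -
  interpret fractional_multicover V E b x
    rewrites "delta V E b = \<delta>"
    using assms(1-4,7) by unfold_locales (auto simp: lp_optimal_def assms(4))
  define K where "K = lp_Opt V E b"
  let ?rnd = "rounding V E b x"
  let ?alg = "set_b_multicover_alg V E b \<alpha> t x rep"
  let ?unc = "\<lambda>R. card {v \<in> V. \<not> fully_covered b (F1 \<union> R) v}"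
  have K_sum: "(\<Sum>e\<in>E. x e) = K"
    using lp_Opt_eq[OF assms(7)] by (simp add: K_def)
  have K_Opt: "K \<le> real (Opt V E b)"
    using lp_Opt_le_Opt[OF assms(1,3,7)] by (simp add: K_def)
  have lambda: "\<Lambda> = (\<delta> + 1) / 2"
    by (simp add: lambda_def assms(4))
  have alg: "?alg = bind_pmf ?rnd (\<lambda>R. rep (F1 \<union> R))"
    using assms(9,10) by (simp add: set_b_multicover_alg_def)
  have outcome: "repair_outcome V b F3 (F1 \<union> R) C" if "C \<in> set_pmf (rep (F1 \<union> R))" for R C
    using assms(8) that by (auto simp: repair_strategy_def)

  have "real (73 * card F1) < real (card F2)"
    using assms(6,10) by simp
  then have "73 * card F1 < card F2"
    by (simp only: of_nat_less_iff)
  then have card_F2: "74 \<le> real (card F2)"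
    using card_C1_pos by simp
  then have "F2 \<noteq> {}"
    by auto
  then obtain e where "1 / \<delta> \<le> x e" "x e < 1 / \<Lambda>"
    by (auto simp: C2_def assms(4))
  \<comment> \<open>For \<open>\<delta> = 1\<close> the interval that defines \<^const>\<open>C2\<close> would be empty.\<close>
  then have "1 / \<delta> < 1 / \<Lambda>"
    by linarith
  then have "1 < \<delta>"
    using delta_ge_1 lambda_ge_1 by (simp add: lambda field_simps)
  \<comment> \<open>By its definition, \<open>\<delta>\<close> is an integer.\<close>
  then have delta2: "2 \<le> \<delta>"
    by (simp add: assms(4) delta_def)
  have deltaK: "74 \<le> \<delta> * K"
    using card_C2_le card_F2 by (simp add: K_sum)
  then have K_pos: "0 < K"
    using delta2 mult_nonneg_nonpos[of \<delta> K] by linarith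

  have card_V: "real (card V) \<le> \<delta> * exp (\<delta> / 4) * K / 47"
  proof -
    define B where "B = real (min_demand V b) - 1"
    have B: "0 < B"
      using min_demand_ge_2 by (simp add: B_def)
    have "max_edge_size E \<noteq> 0"
      using assms(5,9) by (intro notI) simp
    then have "real (max_edge_size E) * (\<alpha> * K) = B * (\<delta> * exp (\<delta> / 4) * K / 47)"
      by (simp add: assms(5) B_def)
    moreover have "real (max_edge_size E) * real (card F1) \<le> real (max_edge_size E) * (\<alpha> * K)"
      using assms(9) by (intro mult_left_mono) (auto simp: K_def)
    ultimately have "B * real (card V) \<le> B * (\<delta> * exp (\<delta> / 4) * K / 47)"
      using card_V_le unfolding B_def by linarith
    with B show ?thesis
      by simp
  qed

  have uncovered: "measure_pmf.prob ?rnd {R. \<delta> * K / 20 \<le> real (?unc R)} \<le> 10 / 47"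
  proof -
    have "measure_pmf.prob ?rnd {R. \<delta> * K / 20 \<le> real (?unc R)} \<le>
        real (card V) * exp (- \<Lambda>) / (\<delta> * K / 20)"
      using deltaK finite_V prob_not_fully_covered_le by (intro prob_card_events_ge_le) auto
    also have "\<dots> \<le> (\<delta> * exp (\<delta> / 4) * K / 47) * exp (- \<Lambda>) / (\<delta> * K / 20)"
      using card_V deltaK by (intro divide_right_mono mult_right_mono) auto
    also have "\<dots> = 20 / 47 * (exp (\<delta> / 4) * exp (- \<Lambda>))"
      using delta2 K_pos by (simp add: field_simps)
    also have "exp (\<delta> / 4) * exp (- \<Lambda>) = exp (- (\<delta> / 4 + 1 / 2))"
      by (simp add: lambda exp_add[symmetric] field_simps)
    also have "\<dots> \<le> exp (- 1)"
      using delta2 by simp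
    also have "\<dots> \<le> 1 / 2"
      using exp_ge_add_one_self[of 1] by (simp add: exp_minus field_simps)
    finally show ?thesis
      by simp
  qed

  define m where "m = (\<Sum>e\<in>F3. \<Lambda> * x e)"
  have m: "real (card F1) + m \<le> \<Lambda> * K"
    using card_C1_plus_mean_le by (simp add: m_def K_sum sum_distrib_left)
  \<comment> \<open>For a deviation by the factor \<open>7/5\<close> the best Chernoff parameter is \<open>ln (7/5)\<close>; the nearby value
    \<open>2/5\<close> loses little and allows the simple estimate \<open>exp (2/5) \<le> 3/2\<close>. As \<open>m \<le> \<lambda> K\<close>, the exponent is at
    most \<open>m/10 - 4/25 \<lambda> K \<le> - 3/50 \<lambda> K\<close>.\<close>
  have large: "measure_pmf.prob ?rnd {R. m + 2 / 5 * (\<Lambda> * K) \<le> real (card R)} \<le> 1 / 5"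
  proof -
    have "exp (2 / 5) \<le> (3 / 2 :: real)"
    proof (rule power_le_imp_le_base)
      have "exp (2 / 5 :: real) ^ Suc 4 = exp 1 ^ 2"
        by (simp add: exp_of_nat_mult[symmetric])
      also have "\<dots> \<le> 2.72 ^ 2"
        using e_less_272 by (intro power_mono) auto
      also have "\<dots> \<le> (3 / 2 :: real) ^ Suc 4"
        by (simp add: power_numeral_reduce)
      finally show "exp (2 / 5 :: real) ^ Suc 4 \<le> (3 / 2) ^ Suc 4" .
    qed simp
    moreover have "0 \<le> m"
      unfolding m_def using rounding_prob_range by (intro sum_nonneg) auto
    ultimately have "(exp (2 / 5) - 1) * m \<le> 1 / 2 * m"
      by (intro mult_right_mono) auto
    moreover have "37 \<le> \<Lambda> * K"
      using deltaK K_pos by (simp add: lambda field_simps)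
    ultimately have exponent:
      "(exp (2 / 5) - 1) * m - 2 / 5 * (m + 2 / 5 * (\<Lambda> * K)) \<le> - 2"
      using m by (simp add: field_simps)
    have "measure_pmf.prob ?rnd {R. m + 2 / 5 * (\<Lambda> * K) \<le> real (card R)} \<le>
        exp ((exp (2 / 5) - 1) * m - 2 / 5 * (m + 2 / 5 * (\<Lambda> * K)))"
      unfolding rounding_eq m_def
      using finite_F rounding_prob_range by (intro prob_card_random_subset_ge_le) auto
    also have "\<dots> \<le> exp (- 2)"
      using exponent by simp
    also have "\<dots> \<le> 1 / 5"
      using exp_lower_Taylor_quadratic[of 2] by (simp add: exp_minus field_simps)
    finally show ?thesis .
  qed

  define T where "T = (15 * \<delta> + 14) / 20 * real (Opt V E b)"
  have T: "7 / 5 * (\<Lambda> * K) + \<delta> * K / 20 \<le> T"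
  proof -
    have "7 / 5 * (\<Lambda> * K) + \<delta> * K / 20 = (15 * \<delta> + 14) / 20 * K"
      by (simp add: lambda field_simps)
    also have "\<dots> \<le> T"
      unfolding T_def using K_Opt delta2 by (intro mult_left_mono) auto
    finally show ?thesis .
  qed
  have "measure_pmf.prob ?alg {C. T \<le> real (card C)} \<le>
      measure_pmf.prob ?rnd ({R. \<delta> * K / 20 \<le> real (?unc R)} \<union>
        {R. m + 2 / 5 * (\<Lambda> * K) \<le> real (card R)})"
    unfolding alg
  proof (rule prob_bind_pmf_le)
    fix R C
    assume R: "R \<in> set_pmf ?rnd" and C: "C \<in> set_pmf (rep (F1 \<union> R))" "C \<in> {C. T \<le> real (card C)}"
    have "real (card C) \<le> real (card F1) + real (card R) + real (?unc R)"
      using card_repaired_le[OF R outcome[OF C(1)]] by linarith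
    then show "R \<in> {R. \<delta> * K / 20 \<le> real (?unc R)} \<union>
        {R. m + 2 / 5 * (\<Lambda> * K) \<le> real (card R)}"
      using C(2) T m by auto
  qed
  also have "\<dots> \<le> 10 / 47 + 1 / 5"
    using uncovered large by (intro order.trans[OF measure_Un_le]) auto
  finally have fail: "measure_pmf.prob ?alg {C. T \<le> real (card C)} < 0.47"
    by simp
  have compl: "{C. real (card C) < T} = UNIV - {C. T \<le> real (card C)}"
    by auto
  have "measure_pmf.prob ?alg {C. real (card C) < T} > 0.53"
    unfolding compl using fail measure_pmf.prob_compl[of "{C. T \<le> real (card C)}" ?alg] by simp
  moreover have "\<forall>C\<in>set_pmf ?alg. set_multicover V E b C"
    using repaired_multicover outcome by (auto simp: alg)
  ultimately show ?thesis
    by (simp add: T_def)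
qed

end
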